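(* Let $\{\varphi_r\}_{0<r<1}$ be a regular approximate identity consisting of even functions and let $\lambda:(0,1)\to(0,\infty)$ with $\lim_{r\to1}\lambda(r)=0$ satisfy $$\Pi_\infty(\lambda,\varphi)=\limsup_{\delta\to0}\limsup_{r\to1}\int_{-\delta\lambda(r)}^{\delta\lambda(r)}\varphi_r(t)\,dt>0 .$$ Then there exists a (measurable) set $E\subset\mathbb T$ such that $\Phi_r(x,\mathbb I_E)$ is $\lambda(r)$-divergent at every $x\in\mathbb T$.
   Context: $\mathbb T=\mathbb R/2\pi\mathbb Z$; points are represented by $t$ with $|t|\le\pi$. An approximate identity is a family $\{\varphi_r\}_{0<r<1}\subset L^\infty(\mathbb T)$ such that: ($\Phi1$) $\int_{\mathbb T}\varphi_r(t)\,dt\to1$ as $r\to1$; ($\Phi2$) $\varphi_r^*(x):=\sup_{|x|\le|t|\le\pi}|\varphi_r(t)|\to0$ as $r\to1$ for each $0<|x|\le\pi$; ($\Phi3$) $C_\varphi:=\sup_{0<r<1}\|\varphi_r^*\|_1<\infty$. It is regular if each $\varphi_r$ is non-negative, decreasing on $[0,\pi]$ and increasing on $[-\pi,0]$. In $\Pi_\infty$, $\delta\to0$ through positive values. $\mathbb I_E$ is the indicator function of $E$ and $\Phi_r(x,f):=\int_{\mathbb T}\varphi_r(x-t)f(t)\,dt$. $\lambda(r,x)$ is the interval $[x-\lambda(r),x+\lambda(r)]\subset\mathbb T$ (equal to $\mathbb T$ if $\lambda(r)\ge\pi$). A family $F_r$ is $\lambda(r)$-convergent at $x$ to $A$ if $\lim_{r\to1}\sup_{\theta\in\lambda(r,x)}|F_r(\theta)-A|=0$;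 it is $\lambda(r)$-divergent at $x$ if it is not $\lambda(r)$-convergent at $x$ to any $A\in\mathbb R$. *)

theory Defs
  imports "HOL-Analysis.Analysis" "HOL-Library.Periodic_Fun"
begin

text \<open>
  The circle is \<open>\<real> / 2\<pi>\<int>\<close>. Functions on it are \<open>2\<pi>\<close>-periodic functions on the real line, subsets
  of it are \<open>2\<pi>\<close>-periodic sets of reals, and integrals over it are taken over \<open>[-\<pi>, \<pi>]\<close> with respect
  to unnormalised Lebesgue measure. A family \<open>\<phi>\<^sub>r\<close>, \<open>0 < r < 1\<close>, is a function \<open>\<phi> r t\<close> whose values
  for \<open>r\<close> outside \<open>(0, 1)\<close> are irrelevant; \<open>r \<rightarrow> 1\<close> is the filter \<open>at_left 1\<close>.
\<close>

definition periodic_set :: "real set \<Rightarrow> bool" where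
  "periodic_set E \<longleftrightarrow> periodic_fun_simple (\<lambda>t. t \<in> E) (2 * pi)"

definition Linf_circle :: "(real \<Rightarrow> real) \<Rightarrow> bool" where
  "Linf_circle f \<longleftrightarrow> periodic_fun_simple f (2 * pi) \<and> f \<in> borel_measurable lebesgue \<and>
     (\<exists>C. AE t in lebesgue. \<bar>f t\<bar> \<le> C)"

text \<open>
  Suprema that could a priori be infinite are taken in \<^typ>\<open>ennreal\<close>, since \<open>Sup\<close> on the reals is
  unspecified for unbounded sets. The supremum here is the pointwise one.
\<close>

definition radial_majorant :: "(real \<Rightarrow> real) \<Rightarrow> real \<Rightarrow> ennreal" where
  "radial_majorant f x = (SUP t\<in>{t. \<bar>x\<bar> \<le> \<bar>t\<bar> \<and> \<bar>t\<bar> \<le> pi}. ennreal \<bar>f t\<bar>)"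

definition approximate_identity :: "(real \<Rightarrow> real \<Rightarrow> real) \<Rightarrow> bool" where
  "approximate_identity \<phi> \<longleftrightarrow>
     (\<forall>r\<in>{0<..<1}. Linf_circle (\<phi> r)) \<and>
     ((\<lambda>r. LINT t:{-pi..pi}|lebesgue. \<phi> r t) \<longlongrightarrow> 1) (at_left 1) \<and>
     (\<forall>x. 0 < \<bar>x\<bar> \<and> \<bar>x\<bar> \<le> pi \<longrightarrow> ((\<lambda>r. radial_majorant (\<phi> r) x) \<longlongrightarrow> 0) (at_left 1)) \<and>
     (SUP r\<in>{0<..<1}. \<integral>\<^sup>+x\<in>{-pi..pi}. radial_majorant (\<phi> r) x \<partial>lebesgue) < \<infinity>"

definition regular_approximate_identity :: "(real \<Rightarrow> real \<Rightarrow> real) \<Rightarrow> bool" where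
  "regular_approximate_identity \<phi> \<longleftrightarrow>
     approximate_identity \<phi> \<and>
     (\<forall>r\<in>{0<..<1}. (\<forall>t. 0 \<le> \<phi> r t) \<and> antimono_on {0..pi} (\<phi> r) \<and> mono_on {-pi..0} (\<phi> r))"

definition Pi_infty :: "(real \<Rightarrow> real) \<Rightarrow> (real \<Rightarrow> real \<Rightarrow> real) \<Rightarrow> ereal" where
  "Pi_infty lam \<phi> =
     Limsup (at_right 0) (\<lambda>\<delta>. Limsup (at_left 1)
       (\<lambda>r. ereal (LINT t:{- \<delta> * lam r..\<delta> * lam r}|lebesgue. \<phi> r t)))"

definition conv_mean :: "(real \<Rightarrow> real \<Rightarrow> real) \<Rightarrow> real \<Rightarrow> real \<Rightarrow> (real \<Rightarrow> real) \<Rightarrow> real" where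
  "conv_mean \<phi> r x f = (LINT t:{-pi..pi}|lebesgue. \<phi> r (x - t) * f t)"

text \<open>
  For a periodic family \<open>F r\<close> the interval \<open>[x - \<lambda>(r), x + \<lambda>(r)]\<close> of the real line needs no truncation:
  if \<open>\<lambda>(r) \<ge> \<pi>\<close>, it covers the whole circle.
\<close>

definition lam_convergent ::
    "(real \<Rightarrow> real) \<Rightarrow> (real \<Rightarrow> real \<Rightarrow> real) \<Rightarrow> real \<Rightarrow> real \<Rightarrow> bool" where
  "lam_convergent lam F x A \<longleftrightarrow>
     ((\<lambda>r. SUP \<theta>\<in>{x - lam r..x + lam r}. ennreal \<bar>F r \<theta> - A\<bar>) \<longlongrightarrow> 0) (at_left 1)"

definition lam_divergent :: "(real \<Rightarrow> real) \<Rightarrow> (real \<Rightarrow> real \<Rightarrow> real) \<Rightarrow> real \<Rightarrow> bool" where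
  "lam_divergent lam F x \<longleftrightarrow> (\<nexists>A. lam_convergent lam F x A)"

end

theory Submission imports Defs begin

text \<open>
  Since \<open>\<Pi>\<^sub>\<infinity>(\<lambda>, \<phi>) > 0\<close>, there is a fixed \<open>p > 0\<close> such that for every \<open>\<delta> > 0\<close> the kernel \<open>\<phi>\<^sub>r\<close> puts mass
  at least \<open>p\<close> on \<open>[-\<delta>\<lambda>(r), \<delta>\<lambda>(r)]\<close> for some \<open>r\<close> arbitrarily close to \<open>1\<close>. So \<open>\<Phi>\<^sub>r\<close> can see sets that are
  very thin compared with \<open>\<lambda>(r)\<close>. The set \<open>E\<close> is obtained by toggling infinitely many thin periodic sets
  \<open>S\<^sub>0, S\<^sub>1, \<dots>\<close>, each tuned to one parameter \<open>r\<^sub>k\<close> from a sequence tending to \<open>1\<close>.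
  
  The circle is divided into \<open>m\<^sub>k\<close> blocks of length \<open>H = 2\<pi> / m\<^sub>k \<le> \<lambda>(r\<^sub>k)\<close>, each block into \<open>n\<^sub>k\<^sup>2\<close> cells with \<open>n\<^sub>k\<close>
  odd, and \<open>S\<^sub>k\<close> consists of the middle cells of all blocks. If \<open>m\<^sub>k\<close> is a multiple of all earlier numbers of
  cells, the set \<open>T\<^sub>k\<close> built from \<open>S\<^sub>0, \<dots>, S\<^bsub>k-1\<^esub>\<close> is constant on every block. Hence around the centre \<open>y\<close> of
  a block, \<open>T\<^bsub>k+1\<^esub>\<close> is, up to complement, a single short cell in an otherwise empty block.
  
  For such a set \<open>\<Phi>\<^bsub>r\<^sub>k\<^esub>\<close> must drop by almost \<open>p\<close> between \<open>y\<close> and \<open>y + H / n\<^sub>k\<close>, whatever the set is outside the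
  block (lemma \<open>mean_drop_at_bump\<close>). The cell itself contributes \<open>p\<close> at \<open>y\<close> and almost nothing at
  \<open>y + H / n\<^sub>k\<close>, because cell width, shift and block length are in the ratio \<open>1 : n\<^sub>k : n\<^sub>k\<^sup>2\<close>. Outside the block
  the kernel is monotone on either side, so the total variation of a shift by \<open>\<tau> = H / n\<^sub>k\<close> is of order
  \<open>\<tau> \<phi>\<^bsub>r\<^sub>k\<^esub>(H / 4)\<close>, and \<open>\<phi>\<^bsub>r\<^sub>k\<^esub>(s) \<le> 1 / s\<close> by monotonicity makes this of order \<open>1 / n\<^sub>k\<close>. Every point of the
  circle has a block centre \<open>y\<close> with \<open>y\<close> and \<open>y + H / n\<^sub>k\<close> in its \<open>\<lambda>(r\<^sub>k)\<close>-interval, so there are no exceptional points.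
  
  Finally \<open>S\<^sub>k\<close> has measure at most \<open>6\<pi> / n\<^sub>k\<^sup>2\<close>. As \<open>n\<^sub>k\<close> is chosen after \<open>\<phi>\<^bsub>r\<^sub>j\<^esub>(0)\<close>, the sup norm of the kernel,
  is known for all \<open>j < k\<close>, the later sets change \<open>\<Phi>\<^bsub>r\<^sub>j\<^esub>\<close> by at most \<open>p / 8\<close>, and an oscillation of \<open>p / 2\<close>
  survives in the limit set.
\<close>

section \<open>Integrals over the circle\<close>

lemma set_integrable_Icc_bounded:
  fixes f :: "real \<Rightarrow> real"
  assumes "f \<in> borel_measurable lebesgue" and "\<And>t. t \<in> {a..b} \<Longrightarrow> \<bar>f t\<bar> \<le> B"
  shows "set_integrable lebesgue {a..b} f"
proof (rule measurable_bounded_by_integrable_imp_absolutely_integrable)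
  show "f \<in> borel_measurable (lebesgue_on {a..b})"
    using assms(1) by (rule measurable_restrict_space1)
  show "(\<lambda>_. B) integrable_on {a..b}" by (rule integrable_const_ivl)
qed (use assms(2) in auto)

lemma set_integrable_Icc_const: "set_integrable lebesgue {a..b::real} (\<lambda>_. c::real)"
  by (rule set_integrable_Icc_bounded[where B = "\<bar>c\<bar>"]) auto

lemma integral_const_Icc:
  fixes a b c :: real
  assumes "a \<le> b"
  shows "(LINT t:{a..b}|lebesgue. c) = (b - a) * c"
  using assms by (simp add: set_lebesgue_integral_def)

lemma translate_borel_measurable_lebesgue:
  fixes f :: "real \<Rightarrow> real"
  assumes "f \<in> borel_measurable lebesgue"
  shows "(\<lambda>t. f (t + c)) \<in> borel_measurable lebesgue"
  using measurable_compose[OF lebesgue_affine_measurable[where c = "\<lambda>_::real. 1" and t = c] assms]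
  by (simp add: add.commute)

text \<open>
  After reduction of \<open>c\<close> to a shift \<open>d\<close> in \<open>[0, 2\<pi>]\<close>, the part of \<open>[-\<pi> + d, \<pi> + d]\<close> beyond \<open>\<pi>\<close> is moved back by a
  period and fills the missing part of \<open>[-\<pi>, \<pi>]\<close>.
\<close>
lemma integral_circle_shift:
  fixes g :: "real \<Rightarrow> real"
  assumes per: "periodic_fun_simple g (2 * pi)"
    and meas: "g \<in> borel_measurable lebesgue" and bdd: "\<And>t. \<bar>g t\<bar> \<le> B"
  shows "(LINT t:{-pi..pi}|lebesgue. g (t + c)) = (LINT t:{-pi..pi}|lebesgue. g t)"
proof -
  interpret periodic_fun_simple g "2 * pi" by (rule per)
  define d where "d = c - 2 * pi * of_int \<lfloor>c / (2 * pi)\<rfloor>"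
  have d: "0 \<le> d" "d \<le> 2 * pi"
    using floor_divide_lower[of "2 * pi" c] floor_divide_upper[of "2 * pi" c]
    by (simp_all add: d_def algebra_simps)
  have gd: "g (t + c) = g (t + d)" for t
    using plus_of_int[of "t + d" "\<lfloor>c / (2 * pi)\<rfloor>"] by (simp add: d_def algebra_simps)
  have si: "set_integrable lebesgue {x..y} g" for x y
    by (rule set_integrable_Icc_bounded[OF meas bdd])
  have int: "g integrable_on {x..y}" for x y
    by (rule set_lebesgue_integral_eq_integral(1)[OF si])
  have "(LINT t:{-pi..pi}|lebesgue. g (t + c)) = (LINT t:{-pi..pi}|lebesgue. g (t + d))"
    by (simp add: gd)
  also have "\<dots> = integral {-pi..pi} (\<lambda>t. g (t + d))"
    by (rule set_lebesgue_integral_eq_integral(2)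
        [OF set_integrable_Icc_bounded[OF translate_borel_measurable_lebesgue[OF meas] bdd]])
  also have "\<dots> = integral {-pi + d..pi + d} g"
    using integral_shift_real_ivl[of "-pi + d" d "pi + d" g] by simp
  also have "\<dots> = integral {-pi + d..pi} g + integral {pi..pi + d} g"
    by (rule Henstock_Kurzweil_Integration.integral_combine[symmetric]) (use d int in auto)
  also have "integral {pi..pi + d} g = integral {-pi..-pi + d} (\<lambda>t. g (t + 2 * pi))"
    using integral_shift_real_ivl[of pi "2 * pi" "pi + d" g] by (simp add: algebra_simps)
  also have "\<dots> = integral {-pi..-pi + d} g"
    by (simp add: plus_period)
  also have "integral {-pi + d..pi} g + integral {-pi..-pi + d} g = integral {-pi..pi} g"
    using Henstock_Kurzweil_Integration.integral_combine[of "-pi" "-pi + d" pi g] d int by simp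
  finally show ?thesis
    by (simp add: set_lebesgue_integral_eq_integral(2)[OF si])
qed

text \<open>
  The form in which the effect of all later modifications is summed: \<open>c\<close> is the sup norm of a kernel.
  It is not divided out, as it may vanish.
\<close>
lemma measure_UN_geometric:
  fixes c b :: real
  assumes "\<And>i. A i \<in> fmeasurable M" "0 \<le> c" "0 \<le> b" and le: "\<And>i. c * measure M (A i) \<le> b * (1 / 2) ^ Suc i"
  shows "c * measure M (\<Union>i. A i) \<le> b"
proof (cases "c = 0")
  case False
  then have c: "0 < c" using assms(2) by simp
  have "measure M (\<Union>i. A i) \<le> b / c"
  proof (rule measure_UN_bound)
    fix I :: "nat set" assume "finite I"
    then have "measure M (\<Union>i\<in>I. A i) \<le> (\<Sum>i\<in>I. measure M (A i))"
      by (rule measure_UNION_le) (use assms(1) in auto)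
    also have "\<dots> \<le> (\<Sum>i\<in>I. b / c * (1 / 2) ^ Suc i)"
      using le c by (intro sum_mono) (simp add: field_simps)
    also have "\<dots> \<le> (\<Sum>i. b / c * (1 / 2) ^ Suc i)"
      using power_half_series[THEN sums_summable] \<open>finite I\<close> c assms(3)
      by (intro sum_le_suminf summable_mult) auto
    also have "\<dots> = b / c * 1"
      by (rule sums_unique[symmetric, OF sums_mult[OF power_half_series]])
    finally show "measure M (\<Union>i\<in>I. A i) \<le> b / c" by simp
  qed (use assms(1) in auto)
  then show ?thesis using c by (simp add: field_simps)
qed (use assms(3) in simp)

section \<open>Convolution with an even, radially decreasing kernel\<close>

locale bell_kernel = periodic_fun_simple f "2 * pi" for f :: "real \<Rightarrow> real" +
  assumes meas: "f \<in> borel_measurable lebesgue"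
    and nonneg: "0 \<le> f t"
    and even_kernel: "f (- t) = f t"
    and antimono: "antimono_on {0..pi} f"
begin

definition mean :: "real \<Rightarrow> (real \<Rightarrow> real) \<Rightarrow> real" where
  "mean x w = (LINT t:{-pi..pi}|lebesgue. f (x - t) * w t)"

lemma decreasing: "0 \<le> s \<Longrightarrow> s \<le> t \<Longrightarrow> t \<le> pi \<Longrightarrow> f t \<le> f s"
  using antimono by (auto simp: monotone_on_def)

lemma decreasing_abs: "\<bar>s\<bar> \<le> \<bar>t\<bar> \<Longrightarrow> \<bar>t\<bar> \<le> pi \<Longrightarrow> f t \<le> f s"
  using decreasing[of "\<bar>s\<bar>" "\<bar>t\<bar>"] even_kernel by (simp add: abs_if split: if_splits)

lemma le_at_0: "f t \<le> f 0"
proof -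
  define k where "k = \<lfloor>t / (2 * pi) + 1 / 2\<rfloor>"
  have "real_of_int k \<le> t / (2 * pi) + 1 / 2" "t / (2 * pi) + 1 / 2 < real_of_int k + 1"
    unfolding k_def by linarith+
  then have "\<bar>t - of_int k * (2 * pi)\<bar> \<le> pi" by (simp add: field_simps abs_le_iff)
  then have "f (t - of_int k * (2 * pi)) \<le> f 0" by (intro decreasing_abs) auto
  then show ?thesis using minus_of_int[of t k] by simp
qed

lemma abs_le_at_0: "\<bar>f t\<bar> \<le> f 0"
  using le_at_0 nonneg by simp

lemma integrable_Icc: "set_integrable lebesgue {a..b} f"
  by (rule set_integrable_Icc_bounded[OF meas abs_le_at_0])

lemma integrable_shift_Icc: "set_integrable lebesgue {a..b} (\<lambda>u. f (u + c))"
  by (rule set_integrable_Icc_bounded[OF translate_borel_measurable_lebesgue[OF meas] abs_le_at_0])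

lemma integral_mono_Icc:
  assumes "{a..b} \<subseteq> {c..d}"
  shows "(LINT t:{a..b}|lebesgue. f t) \<le> (LINT t:{c..d}|lebesgue. f t)"
  unfolding set_lebesgue_integral_def
proof (rule integral_mono)
  show "indicat_real {a..b} t *\<^sub>R f t \<le> indicat_real {c..d} t *\<^sub>R f t" for t
    using assms nonneg[of t] by (cases "t \<in> {a..b}") (auto simp: subset_eq)
qed (use integrable_Icc in \<open>simp_all only: set_integrable_def\<close>)

text \<open>
  By monotonicity the kernel is at least \<open>f s\<close> on all of \<open>[-s, s]\<close>. So a bound on
  the total mass becomes a decay of order \<open>1 / s\<close> at distance \<open>s\<close>, uniformly in the kernel.
\<close>
lemma pointwise_bound:
  assumes "0 < s" "s \<le> pi"
  shows "2 * s * f s \<le> (LINT t:{-pi..pi}|lebesgue. f t)"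
proof -
  have "2 * s * f s = (LINT t:{-s..s}|lebesgue. f s)"
    using assms integral_const_Icc[of "-s" s "f s"] by simp
  also have "\<dots> \<le> (LINT t:{-s..s}|lebesgue. f t)"
    by (rule set_integral_mono)
      (use assms in \<open>auto intro!: decreasing_abs integrable_Icc set_integrable_Icc_const\<close>)
  also have "\<dots> \<le> (LINT t:{-pi..pi}|lebesgue. f t)"
    by (rule integral_mono_Icc) (use assms in auto)
  finally show ?thesis .
qed

text \<open>
  Both \<open>mean x w\<close> and \<open>mean (x + s) w\<close> become integrals against the same function \<open>w (x + u)\<close>, so
  that their difference is governed by \<open>f u - f (u - s)\<close> alone.
\<close>
lemma mean_recentre:
  assumes "periodic_fun_simple w (2 * pi)" "w \<in> borel_measurable lebesgue" "\<And>t. \<bar>w t\<bar> \<le> 1"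
  shows "mean (x + s) w = (LINT u:{-pi..pi}|lebesgue. f (u - s) * w (x + u))"
proof -
  interpret w: periodic_fun_simple w "2 * pi" by fact
  define g where "g = (\<lambda>t. f (t - (x + s)) * w t)"
  have fm: "(\<lambda>t. f (t - (x + s))) \<in> borel_measurable lebesgue"
    using translate_borel_measurable_lebesgue[OF meas, of "- (x + s)"]
    by (simp only: diff_conv_add_uminus)
  have "periodic_fun_simple g (2 * pi)"
  proof
    show "g (t + 2 * pi) = g t" for t
      using plus_period[of "t - (x + s)"] w.plus_period[of t]
      by (simp add: g_def diff_add_eq[symmetric])
  qed
  moreover have "g \<in> borel_measurable lebesgue"
    unfolding g_def using fm assms(2) by measurable
  moreover have "\<bar>g t\<bar> \<le> f 0" for t
    using mult_mono[OF abs_le_at_0 assms(3), of t "t - (x + s)"] abs_le_at_0[of 0]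
    by (simp add: g_def abs_mult)
  ultimately have "(LINT t:{-pi..pi}|lebesgue. g (t + x)) = (LINT t:{-pi..pi}|lebesgue. g t)"
    by (rule integral_circle_shift)
  moreover have "f (x + s - t) = f (t - (x + s))" for t
    using even_kernel[of "t - (x + s)"] by simp
  ultimately show ?thesis
    by (simp add: mean_def g_def add.commute[of _ x])
qed

text \<open>
  The central estimate. By periodicity the difference is the integral of \<open>(f u - f (u - \<tau>)) * w (x + u)\<close>
  over \<open>[-\<pi>, \<pi>]\<close>. On the bump this yields the mass of \<open>f\<close> near \<open>0\<close>, up to the small values
  \<open>f (u - \<tau>) \<le> f (\<tau> - a)\<close>. To the left of the gap \<open>f\<close> increases, so the integrand is nonnegative there, except
  within \<open>\<tau>\<close> of \<open>-\<pi>\<close>, where \<open>u - \<tau>\<close> passes the antipode. To the right of the gap \<open>f\<close> decreases, and the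
  worst case \<open>w = 1\<close> telescopes to an integral over an interval of length \<open>\<tau>\<close>. Beyond the
  distance \<open>R\<close> only \<open>0 \<le> w \<le> 1\<close> enters, so the drop is insensitive to the shape of \<open>w\<close> there.
\<close>
lemma mean_drop_at_bump:
  assumes w: "periodic_fun_simple w (2 * pi)" "w \<in> borel_measurable lebesgue"
      "\<And>t. 0 \<le> w t \<and> w t \<le> 1"
    and bump: "\<And>u. u \<in> {-a..<a} \<Longrightarrow> w (x + u) = 1"
    and gap: "\<And>u. u \<in> {-R..<R} \<Longrightarrow> u \<notin> {-a..<a} \<Longrightarrow> w (x + u) = 0"
    and par: "0 < a" "a < \<tau>" "2 * \<tau> \<le> R" "R \<le> pi"
  shows "(LINT u:{-a..a}|lebesgue. f u) - 2 * a * f (\<tau> - a) - 2 * \<tau> * f (R - \<tau>)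
    \<le> mean x w - mean (x + \<tau>) w"
proof -
  have wb: "\<bar>w t\<bar> \<le> 1" for t using w(3)[of t] by simp
  have wm: "(\<lambda>u. w (x + u)) \<in> borel_measurable lebesgue"
    using translate_borel_measurable_lebesgue[OF w(2), of x] by (simp add: add.commute)
  have fm: "(\<lambda>u. f (u - \<tau>)) \<in> borel_measurable lebesgue"
    using translate_borel_measurable_lebesgue[OF meas, of "-\<tau>"] by simp
  have f0: "0 \<le> f 0" by (rule nonneg)
  have i1: "set_integrable lebesgue {-pi..pi} (\<lambda>u. f u * w (x + u))"
  proof (rule set_integrable_Icc_bounded)
    show "(\<lambda>u. f u * w (x + u)) \<in> borel_measurable lebesgue" using meas wm by measurable
    show "\<bar>f t * w (x + t)\<bar> \<le> f 0 * 1" for t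
      unfolding abs_mult by (intro mult_mono abs_le_at_0 wb f0) auto
  qed
  have i2: "set_integrable lebesgue {-pi..pi} (\<lambda>u. f (u - \<tau>) * w (x + u))"
  proof (rule set_integrable_Icc_bounded)
    show "(\<lambda>u. f (u - \<tau>) * w (x + u)) \<in> borel_measurable lebesgue" using fm wm by measurable
    show "\<bar>f (t - \<tau>) * w (x + t)\<bar> \<le> f 0 * 1" for t
      unfolding abs_mult by (intro mult_mono abs_le_at_0 wb f0) auto
  qed
  \<comment> \<open>The three functions minorise the integrand: \<open>\<psi>1\<close> on the bump, \<open>\<psi>2\<close> to the right of the gap and
    \<open>- \<psi>3\<close> near the antipode.\<close>
  define \<psi>1 where "\<psi>1 = (\<lambda>u. indicat_real {-a..a} u * (f u - f (\<tau> - a)))"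
  define \<psi>2 where "\<psi>2 = (\<lambda>u. indicat_real {R..pi} u * (f u - f (u - \<tau>)))"
  define \<psi>3 where "\<psi>3 = (\<lambda>u. indicat_real {-pi..-pi+\<tau>} u * f (R - \<tau>))"
  have I1: "integrable lebesgue \<psi>1" "(LINT u|lebesgue. \<psi>1 u) = (LINT u:{-a..a}|lebesgue. f u) - 2 * a * f (\<tau> - a)"
  proof -
    note c = set_integrable_Icc_const[of "-a" a "f (\<tau> - a)"]
    show "integrable lebesgue \<psi>1"
      using set_integral_diff(1)[OF integrable_Icc c] by (simp add: \<psi>1_def set_integrable_def)
    show "(LINT u|lebesgue. \<psi>1 u) = (LINT u:{-a..a}|lebesgue. f u) - 2 * a * f (\<tau> - a)"
      using set_integral_diff(2)[OF integrable_Icc c] integral_const_Icc[of "-a" a "f (\<tau> - a)"] par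
      by (simp add: \<psi>1_def set_lebesgue_integral_def)
  qed
  have I2: "integrable lebesgue \<psi>2" "(LINT u|lebesgue. \<psi>2 u) \<ge> - \<tau> * f (R - \<tau>)"
  proof -
    have s: "set_integrable lebesgue {p..q} (\<lambda>u. f (u - \<tau>))" for p q
      using integrable_shift_Icc[of p q "-\<tau>"] by simp
    note int = set_lebesgue_integral_eq_integral[OF integrable_Icc]
    show "integrable lebesgue \<psi>2"
      using set_integral_diff(1)[OF integrable_Icc s] by (simp add: \<psi>2_def set_integrable_def)
    have "(LINT u|lebesgue. \<psi>2 u) = (LINT u:{R..pi}|lebesgue. f u) - (LINT u:{R..pi}|lebesgue. f (u - \<tau>))"
      using set_integral_diff(2)[OF integrable_Icc s]
      by (simp add: \<psi>2_def set_lebesgue_integral_def)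
    moreover have "(LINT u:{R..pi}|lebesgue. f (u - \<tau>)) = (LINT u:{R - \<tau>..pi - \<tau>}|lebesgue. f u)"
      using integral_shift_real_ivl[of "R - \<tau>" "-\<tau>" "pi - \<tau>" f]
      by (simp add: int set_lebesgue_integral_eq_integral[OF s])
    moreover have "(LINT u:{R - \<tau>..R}|lebesgue. f u) + (LINT u:{R..pi}|lebesgue. f u) =
        (LINT u:{R - \<tau>..pi}|lebesgue. f u)"
      using Henstock_Kurzweil_Integration.integral_combine[of "R - \<tau>" R pi f] par int(1)
      by (simp add: int)
    moreover have "(LINT u:{R - \<tau>..pi - \<tau>}|lebesgue. f u) \<le> (LINT u:{R - \<tau>..pi}|lebesgue. f u)"
      by (rule integral_mono_Icc) (use par in auto)
    moreover have "(LINT u:{R - \<tau>..R}|lebesgue. f u) \<le> (LINT u:{R - \<tau>..R}|lebesgue. f (R - \<tau>))"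
      by (rule set_integral_mono)
        (use par in \<open>auto intro!: decreasing integrable_Icc set_integrable_Icc_const\<close>)
    moreover have "(LINT u:{R - \<tau>..R}|lebesgue. f (R - \<tau>)) = \<tau> * f (R - \<tau>)"
      using integral_const_Icc[of "R - \<tau>" R "f (R - \<tau>)"] par by simp
    ultimately show "(LINT u|lebesgue. \<psi>2 u) \<ge> - \<tau> * f (R - \<tau>)"
      by simp
  qed
  have I3: "integrable lebesgue \<psi>3" "(LINT u|lebesgue. \<psi>3 u) = \<tau> * f (R - \<tau>)"
    using integral_const_Icc[of "-pi" "-pi+\<tau>" "f (R - \<tau>)"] par
      set_integrable_Icc_const[of "-pi" "-pi+\<tau>" "f (R - \<tau>)"]
    by (simp_all add: \<psi>3_def set_lebesgue_integral_def)
  have pointwise: "\<psi>1 u + \<psi>2 u - \<psi>3 u \<le> f u * w (x + u) - f (u - \<tau>) * w (x + u)"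
    if u: "u \<in> {-pi..pi}" "u \<noteq> a" for u
  proof -
    have fR: "0 \<le> f (R - \<tau>)" by (rule nonneg)
    consider "u \<in> {-pi..-pi+\<tau>}" | "u \<in> {-pi+\<tau><..<-R}" | "u \<in> {-R..<R}" "u \<notin> {-a..<a}" "u > -pi+\<tau>"
      | "u \<in> {-a..<a}" | "u \<in> {R..pi}"
      using u by fastforce
    then show ?thesis
    proof cases
      case 1
      \<comment> \<open>Here \<open>u - \<tau>\<close> lies beyond \<open>-\<pi>\<close> and is moved back to the circle.\<close>
      have "f (u - \<tau>) = f (u - \<tau> + 2 * pi)" by (simp add: plus_period)
      also have "\<dots> \<le> f (R - \<tau>)"
        by (rule decreasing) (use 1 par in auto)
      finally have "f (u - \<tau>) * w (x + u) \<le> f (R - \<tau>) * 1"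
        using w(3)[of "x + u"] fR by (intro mult_mono) auto
      moreover have "0 \<le> f u * w (x + u)" using w(3) nonneg by simp
      moreover have "\<psi>1 u = 0" "\<psi>2 u = 0" using 1 par by (auto simp: \<psi>1_def \<psi>2_def)
      ultimately show ?thesis using 1 by (simp add: \<psi>3_def)
    next
      case 2
      have "f (u - \<tau>) \<le> f u" by (rule decreasing_abs) (use 2 par in auto)
      then have "f (u - \<tau>) * w (x + u) \<le> f u * w (x + u)"
        using w(3) by (intro mult_right_mono) auto
      moreover have "\<psi>1 u = 0" "\<psi>2 u = 0" "\<psi>3 u = 0" using 2 par by (auto simp: \<psi>1_def \<psi>2_def \<psi>3_def)
      ultimately show ?thesis by simp
    next
      case 3
      then have "\<psi>1 u = 0" "\<psi>2 u = 0" "\<psi>3 u = 0"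
        using par u by (auto simp: \<psi>1_def \<psi>2_def \<psi>3_def indicator_def)
      then show ?thesis using gap 3 by simp
    next
      case 4
      have "f (u - \<tau>) \<le> f (\<tau> - a)" by (rule decreasing_abs) (use 4 par in auto)
      moreover have "\<psi>2 u = 0" "\<psi>3 u = 0" using 4 par by (auto simp: \<psi>2_def \<psi>3_def)
      ultimately show ?thesis using bump[OF 4] 4 by (simp add: \<psi>1_def)
    next
      case 5
      have "f u \<le> f (u - \<tau>)" by (rule decreasing_abs) (use 5 par in auto)
      then have "(f (u - \<tau>) - f u) * w (x + u) \<le> (f (u - \<tau>) - f u) * 1"
        using w(3) by (intro mult_left_mono) auto
      moreover have "\<psi>1 u = 0" "\<psi>3 u = 0" using 5 par by (auto simp: \<psi>1_def \<psi>3_def)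
      ultimately show ?thesis using 5 by (simp add: \<psi>2_def algebra_simps)
    qed
  qed
  have "(LINT u|lebesgue. \<psi>1 u + \<psi>2 u - \<psi>3 u)
      \<le> (LINT u:{-pi..pi}|lebesgue. f u * w (x + u) - f (u - \<tau>) * w (x + u))"
    unfolding set_lebesgue_integral_def
  proof (rule integral_mono_AE)
    show "integrable lebesgue (\<lambda>u. \<psi>1 u + \<psi>2 u - \<psi>3 u)" using I1 I2 I3 by simp
    show "integrable lebesgue (\<lambda>u. indicat_real {-pi..pi} u *\<^sub>R (f u * w (x + u) - f (u - \<tau>) * w (x + u)))"
      using set_integral_diff(1)[OF i1 i2] by (simp add: set_integrable_def)
    \<comment> \<open>The bump is half-open, and \<open>\<psi>1\<close> lives on its closure.\<close>
    have "AE u in lebesgue. u \<noteq> a"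
      by (rule AE_I'[of "{a}"]) auto
    then show "AE u in lebesgue. \<psi>1 u + \<psi>2 u - \<psi>3 u
        \<le> indicat_real {-pi..pi} u *\<^sub>R (f u * w (x + u) - f (u - \<tau>) * w (x + u))"
    proof eventually_elim
      case (elim u)
      show ?case
      proof (cases "u \<in> {-pi..pi}")
        case False
        then have "\<psi>1 u = 0" "\<psi>2 u = 0" "\<psi>3 u = 0"
          using par by (auto simp: \<psi>1_def \<psi>2_def \<psi>3_def indicator_def)
        with False show ?thesis by simp
      qed (use pointwise[OF _ elim] in simp)
    qed
  qed
  also have "\<dots> = mean x w - mean (x + \<tau>) w"
    using mean_recentre[OF w(1,2) wb, of x 0] mean_recentre[OF w(1,2) wb, of x \<tau>]
      set_integral_diff(2)[OF i1 i2] by simp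
  finally show ?thesis
    using I1 I2 I3 by simp
qed

lemma integrable_mult_bounded:
  assumes "w \<in> borel_measurable lebesgue" "\<And>t. \<bar>w t\<bar> \<le> 1"
  shows "set_integrable lebesgue {a..b} (\<lambda>u. f u * w (x + u))"
proof (rule set_integrable_Icc_bounded)
  have "(\<lambda>u. w (x + u)) \<in> borel_measurable lebesgue"
    using translate_borel_measurable_lebesgue[OF assms(1), of x] by (simp add: add.commute)
  then show "(\<lambda>u. f u * w (x + u)) \<in> borel_measurable lebesgue" using meas by measurable
  show "\<bar>f t * w (x + t)\<bar> \<le> f 0 * 1" for t
    unfolding abs_mult by (intro mult_mono abs_le_at_0 assms(2) nonneg) auto
qed

text \<open>
  Exchanges a bump for a hole: differences of means only change their sign under complementation.
\<close>
lemma mean_complement: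
  assumes w: "periodic_fun_simple w (2 * pi)" "w \<in> borel_measurable lebesgue"
      "\<And>t. 0 \<le> w t \<and> w t \<le> 1"
  shows "mean x (\<lambda>t. 1 - w t) = (LINT t:{-pi..pi}|lebesgue. f t) - mean x w"
proof -
  interpret w: periodic_fun_simple w "2 * pi" by fact
  have wb: "\<bar>w t\<bar> \<le> 1" "\<bar>1 - w t\<bar> \<le> 1" for t using w(3)[of t] by simp_all
  have "periodic_fun_simple (\<lambda>t. 1 - w t) (2 * pi)"
    by unfold_locales (simp add: w.plus_period)
  moreover have "(\<lambda>t. 1 - w t) \<in> borel_measurable lebesgue" using w(2) by measurable
  ultimately have "mean x (\<lambda>t. 1 - w t) = (LINT u:{-pi..pi}|lebesgue. f u * (1 - w (x + u)))"
    using mean_recentre[of "\<lambda>t. 1 - w t" x 0] wb(2) by simp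
  also have "\<dots> = (LINT u:{-pi..pi}|lebesgue. f u - f u * w (x + u))"
    by (simp add: right_diff_distrib)
  also have "\<dots> = (LINT t:{-pi..pi}|lebesgue. f t) - (LINT u:{-pi..pi}|lebesgue. f u * w (x + u))"
    by (rule set_integral_diff(2)[OF integrable_Icc integrable_mult_bounded[OF w(2) wb(1)]])
  also have "(LINT u:{-pi..pi}|lebesgue. f u * w (x + u)) = mean x w"
    using mean_recentre[OF w(1,2) wb(1), of x 0] by simp
  finally show ?thesis .
qed

text \<open>
  The sup norm of the kernel is \<open>f 0\<close>, so modifications of small measure are harmless at a fixed scale.
\<close>
lemma mean_indicator_close:
  assumes "A \<in> sets lebesgue" "B \<in> sets lebesgue" "D \<in> lmeasurable"
    and agree: "\<And>t. t \<in> {-pi..pi} \<Longrightarrow> t \<notin> D \<Longrightarrow> t \<in> A \<longleftrightarrow> t \<in> B"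
  shows "\<bar>mean x (indicator A) - mean x (indicator B)\<bar> \<le> f 0 * measure lebesgue D"
proof -
  have fx: "(\<lambda>t. f (x - t)) \<in> borel_measurable lebesgue"
  proof -
    have "f (x - t) = f (t + - x)" for t using even_kernel[of "t - x"] by simp
    then show ?thesis using translate_borel_measurable_lebesgue[OF meas, of "- x"] by (simp only:)
  qed
  have i: "set_integrable lebesgue {-pi..pi} (\<lambda>t. f (x - t) * indicat_real A t)"
    if "A \<in> sets lebesgue" for A
  proof (rule set_integrable_Icc_bounded)
    show "(\<lambda>t. f (x - t) * indicat_real A t) \<in> borel_measurable lebesgue"
      using fx that by measurable
    show "\<bar>f (x - t) * indicat_real A t\<bar> \<le> f 0" for t
      using abs_le_at_0[of "x - t"] nonneg[of 0] by (simp add: indicator_def)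
  qed
  define g where "g = (\<lambda>t. indicat_real {-pi..pi} t * (f (x - t) * indicat_real A t - f (x - t) * indicat_real B t))"
  have gi: "integrable lebesgue g"
    using set_integral_diff(1)[OF i[OF assms(1)] i[OF assms(2)]] by (simp add: g_def set_integrable_def)
  have g_le: "\<bar>g t\<bar> \<le> f 0 * indicat_real D t" for t
  proof (cases "t \<in> {-pi..pi} \<and> t \<in> D")
    case True
    then show ?thesis
      using abs_le_at_0[of "x - t"] nonneg[of 0] by (cases "t \<in> A"; cases "t \<in> B") (simp_all add: g_def)
  next
    case False
    then have "g t = 0" using agree[of t] by (auto simp: g_def indicator_def)
    then show ?thesis using nonneg[of 0] by simp
  qed
  have "mean x (indicator A) - mean x (indicator B) = integral\<^sup>L lebesgue g"
    using set_integral_diff(2)[OF i[OF assms(1)] i[OF assms(2)]]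
    by (simp add: mean_def set_lebesgue_integral_def g_def)
  also have "\<bar>\<dots>\<bar> \<le> (LINT t|lebesgue. \<bar>g t\<bar>)" by (rule integral_abs_bound)
  also have "\<dots> \<le> (LINT t|lebesgue. f 0 * indicat_real D t)"
  proof (rule integral_mono[OF integrable_abs[OF gi] _ g_le])
    show "integrable lebesgue (\<lambda>t. f 0 * indicat_real D t)"
      using assms(3) by (intro integrable_mult_right integrable_real_indicator) (auto simp: fmeasurable_def)
  qed
  also have "\<dots> = f 0 * measure lebesgue D" by simp
  finally show ?thesis .
qed

end

section \<open>Middle cells of a subdivision of the circle\<close>

text \<open>
  With \<open>N = q m\<close> cells of equal length on the circle and \<open>q\<close> odd, these are the middle cells of the \<open>m\<close>
  consecutive blocks of \<open>q\<close> cells. The description by the cell number \<open>\<lfloor>N t / 2\<pi>\<rfloor>\<close> makes periodicity and the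
  compatibility of nested subdivisions matters of integer arithmetic.
\<close>
definition middle_cells :: "nat \<Rightarrow> nat \<Rightarrow> real set" where
  "middle_cells N q = {t. \<lfloor>real N * t / (2 * pi)\<rfloor> mod int q = int q div 2}"

text \<open>
  Membership depends only on the cell of the subdivision of the circle into \<open>M\<close> equal cells. This is how earlier
  stages look from the blocks of a finer one.
\<close>
definition level_constant :: "nat \<Rightarrow> real set \<Rightarrow> bool" where
  "level_constant M A \<longleftrightarrow>
     (\<forall>s t. \<lfloor>real M * s / (2 * pi)\<rfloor> = \<lfloor>real M * t / (2 * pi)\<rfloor> \<longrightarrow> (s \<in> A \<longleftrightarrow> t \<in> A))"

text \<open>
  Taking symmetric differences, rather than unions, lets later stages cut holes into earlier pieces; with
  unions the means would converge inside the pieces.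
\<close>
primrec toggled :: "(nat \<Rightarrow> 'a set) \<Rightarrow> nat \<Rightarrow> 'a set" where
  "toggled S 0 = {}"
| "toggled S (Suc k) = sym_diff (toggled S k) (S k)"

text \<open>
  The lower limit of the finite stages. A point that lies in only finitely many of the sets \<open>S j\<close> belongs to
  it iff it belongs to an odd number of them.
\<close>
definition toggled_limit :: "(nat \<Rightarrow> 'a set) \<Rightarrow> 'a set" where
  "toggled_limit S = (\<Union>k. \<Inter>j\<in>{k..}. toggled S j)"

lemma middle_cells_measurable: "middle_cells N q \<in> sets lebesgue"
proof -
  have "(\<lambda>t. \<lfloor>real N * t / (2 * pi)\<rfloor>) \<in> borel \<rightarrow>\<^sub>M count_space UNIV"
    by measurable
  then have "(\<lambda>t. \<lfloor>real N * t / (2 * pi)\<rfloor>) -` {i. i mod int q = int q div 2} \<inter> space borel \<in> sets borel"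
    by (rule measurable_sets) auto
  then have "middle_cells N q \<in> sets lborel" by (simp add: middle_cells_def vimage_def)
  then show ?thesis by (rule sets_completionI_sets)
qed

lemma middle_cells_periodic:
  assumes "q dvd N"
  shows "t + 2 * pi \<in> middle_cells N q \<longleftrightarrow> t \<in> middle_cells N q"
proof -
  have "real N * (t + 2 * pi) / (2 * pi) = real N * t / (2 * pi) + of_int (int N)"
    by (simp add: field_simps)
  then have "\<lfloor>real N * (t + 2 * pi) / (2 * pi)\<rfloor> = \<lfloor>real N * t / (2 * pi)\<rfloor> + int N"
    by (simp only: floor_add_int)
  moreover obtain l where "N = q * l" using assms by blast
  ultimately show ?thesis by (simp add: middle_cells_def)
qed

lemma level_constant_middle_cells:
  assumes "N dvd M" "0 < M"
  shows "level_constant M (middle_cells N q)"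
proof -
  obtain d where d: "M = N * d" using assms by blast
  have "\<lfloor>real N * t / (2 * pi)\<rfloor> = \<lfloor>real M * t / (2 * pi)\<rfloor> div int d" for t
  proof -
    have "real N * t / (2 * pi) = (real M * t / (2 * pi)) / real_of_int (int d)"
      using d assms by simp
    then show ?thesis
      by (simp only: floor_divide_real_eq_div[of "int d" "real M * t / (2 * pi)"] of_nat_0_le_iff)
  qed
  then show ?thesis by (simp add: level_constant_def middle_cells_def)
qed

lemma level_constant_toggled:
  "(\<And>j. j < k \<Longrightarrow> level_constant M (S j)) \<Longrightarrow> level_constant M (toggled S k)"
proof (induction k)
  case (Suc k)
  then have "level_constant M (toggled S k)" "level_constant M (S k)" by simp_all
  then show ?case unfolding level_constant_def toggled.simps by blast
qed (simp add: level_constant_def)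

text \<open>
  The interval \<open>[-\<pi>, \<pi>]\<close> meets only blocks with index between \<open>-m\<close> and \<open>m\<close>. Counting these \<open>2m + 1 \<le> 3m\<close>
  cells, instead of the exact number \<open>m\<close>, costs a factor that does not matter.
\<close>
lemma measure_middle_cells:
  assumes "0 < q" "0 < m"
  shows "measure lebesgue (middle_cells (q * m) q \<inter> {-pi..pi}) \<le> 6 * pi / real q"
proof -
  define h where "h = 2 * pi / real (q * m)"
  define I where "I = (\<lambda>i::int. {of_int (i * int q + int q div 2) * h .. of_int (i * int q + int q div 2 + 1) * h})"
  have h: "0 < h" using assms by (simp add: h_def)
  have sub: "middle_cells (q * m) q \<inter> {-pi..pi} \<subseteq> (\<Union>i\<in>{- int m..int m}. I i)"
  proof
    fix t assume t: "t \<in> middle_cells (q * m) q \<inter> {-pi..pi}"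
    define l where "l = \<lfloor>t / h\<rfloor>"
    have th: "real (q * m) * t / (2 * pi) = t / h" by (simp add: h_def)
    then have l: "l mod int q = int q div 2" using t by (simp add: middle_cells_def l_def)
    have "l = l div int q * int q + int q div 2" using l by (metis div_mult_mod_eq)
    moreover have "of_int l * h \<le> t" "t \<le> of_int (l + 1) * h"
      using h floor_divide_lower[OF h, of t] floor_divide_upper[OF h, of t] by (simp_all add: l_def)
    ultimately have "t \<in> I (l div int q)"
      unfolding I_def by auto
    moreover have "l div int q \<in> {- int m..int m}"
    proof -
      have "\<bar>t / h\<bar> \<le> real (q * m)"
      proof -
        have "\<bar>t\<bar> \<le> real (q * m) * h" using t assms by (auto simp: h_def)
        then show ?thesis using h by (simp add: pos_divide_le_eq)
      qed
      then have "- real (m * q) \<le> t / h" "t / h < real (m * q) + 1"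
        by (simp_all only: abs_le_iff mult.commute[of q m]) linarith+
      then have "- (int m * int q) \<le> l" "l \<le> int m * int q"
        unfolding l_def by (simp_all add: le_floor_iff floor_le_iff)
      then have "(- int m) * int q div int q \<le> l div int q" "l div int q \<le> int m * int q div int q"
        using assms by (intro zdiv_mono1; simp)+
      then show ?thesis using assms by (simp only: nonzero_mult_div_cancel_right) auto
    qed
    ultimately show "t \<in> (\<Union>i\<in>{- int m..int m}. I i)" by blast
  qed
  have "measure lebesgue (middle_cells (q * m) q \<inter> {-pi..pi}) \<le> measure lebesgue (\<Union>i\<in>{- int m..int m}. I i)"
    by (rule measure_mono_fmeasurable[OF sub]) (auto simp: I_def middle_cells_measurable)
  also have "\<dots> \<le> (\<Sum>i\<in>{- int m..int m}. measure lebesgue (I i))"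
    by (rule measure_UNION_le) (auto simp: I_def)
  also have "\<dots> = (\<Sum>i\<in>{- int m..int m}. h)"
    using h by (intro sum.cong refl) (simp add: I_def algebra_simps)
  also have "\<dots> = real (2 * m + 1) * h" by simp
  also have "\<dots> \<le> real (3 * m) * h"
    using h assms by (intro mult_right_mono) auto
  also have "\<dots> = 6 * pi / real q" using assms by (simp add: h_def)
  finally show ?thesis .
qed

text \<open>
  In the coordinate \<open>y = q u / H + 1 / 2\<close>, where \<open>u\<close> is measured from the centre of block \<open>i\<close>, cell boundaries
  are integers and the middle cell is \<open>0 \<le> y < 1\<close>; oddness of \<open>q\<close> makes the centre of the block the centre
  of that cell.
\<close>
lemma middle_cells_near_centre:
  assumes "odd q" "0 < m" and H: "H = 2 * pi / real m" and x: "x = (of_int i + 1/2) * H"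
    and u: "u \<in> {-H/2..<H/2}"
  shows "\<lfloor>real m * (x + u) / (2 * pi)\<rfloor> = i"
    and "x + u \<in> middle_cells (q * m) q \<longleftrightarrow> u \<in> {-H/(2 * real q)..<H/(2 * real q)}"
proof -
  have Hpos: "0 < H" using assms by simp
  have e: "real m * (x + u) / (2 * pi) = of_int i + (1/2 + u / H)"
  proof -
    have "real m * (x + u) / (2 * pi) = (x + u) / H" by (simp add: H)
    also have "\<dots> = x / H + u / H" by (rule add_divide_distrib)
    also have "x / H = of_int i + 1/2" using x Hpos by simp
    finally show ?thesis by simp
  qed
  have "0 \<le> 1/2 + u / H" "1/2 + u / H < 1"
    using u Hpos by (auto simp: field_simps)
  then show "\<lfloor>real m * (x + u) / (2 * pi)\<rfloor> = i"
    unfolding e by (simp add: floor_eq_iff)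
  obtain c where c: "q = 2 * c + 1" using assms(1) by (rule oddE)
  have q: "0 < real q" using c by simp
  define y where "y = 1/2 + real q * u / H"
  have "real (q * m) * (x + u) / (2 * pi) = real q * (real m * (x + u) / (2 * pi))" by simp
  also have "\<dots> = of_int (i * int q + int c) + y"
    unfolding e by (simp add: y_def c algebra_simps add_divide_distrib)
  finally have fl: "\<lfloor>real (q * m) * (x + u) / (2 * pi)\<rfloor> = i * int q + int c + \<lfloor>y\<rfloor>"
    by (simp only: int_add_floor)
  have "- real c \<le> y" "y < real c + 1"
  proof -
    have "- (1/2) \<le> u / H" "u / H < 1/2" using u Hpos by (auto simp: field_simps)
    then have "real q * (- (1/2)) \<le> real q * (u / H)" "real q * (u / H) < real q * (1/2)"
      using q by (blast intro: mult_left_mono mult_strict_left_mono less_imp_le)+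
    moreover have "real q * (u / H) = y - 1/2" by (simp add: y_def)
    moreover have "real q * (- (1/2)) = - real c - 1/2" "real q * (1/2) = real c + 1/2"
      by (simp_all add: c field_simps)
    ultimately show "- real c \<le> y" "y < real c + 1" by linarith+
  qed
  then have "- int c \<le> \<lfloor>y\<rfloor>" "\<lfloor>y\<rfloor> \<le> int c"
    by (simp_all add: le_floor_iff floor_le_iff)
  then have "(i * int q + int c + \<lfloor>y\<rfloor>) mod int q = int c + \<lfloor>y\<rfloor>"
    by (simp add: c add.assoc)
  moreover have "int q div 2 = int c" by (simp add: c)
  ultimately have "x + u \<in> middle_cells (q * m) q \<longleftrightarrow> \<lfloor>y\<rfloor> = 0"
    unfolding middle_cells_def mem_Collect_eq fl \<open>int q div 2 = int c\<close> by linarith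
  also have "\<dots> \<longleftrightarrow> 0 \<le> y \<and> y < 1" by (simp add: floor_eq_iff)
  also have "\<dots> \<longleftrightarrow> u \<in> {-H/(2 * real q)..<H/(2 * real q)}"
    using Hpos q by (auto simp: y_def field_simps)
  finally show "x + u \<in> middle_cells (q * m) q \<longleftrightarrow> u \<in> {-H/(2 * real q)..<H/(2 * real q)}" .
qed

lemma toggled_measurable: "(\<And>j. S j \<in> sets M) \<Longrightarrow> toggled S k \<in> sets M"
  by (induction k) auto

lemma toggled_limit_measurable:
  assumes "\<And>j. S j \<in> sets M"
  shows "toggled_limit S \<in> sets M"
  unfolding toggled_limit_def
  by (intro sets.countable_UN sets.countable_INT) (use toggled_measurable[of S M, OF assms] in auto)

lemma toggled_cong: "(\<And>j. s \<in> S j \<longleftrightarrow> t \<in> S j) \<Longrightarrow> s \<in> toggled S k \<longleftrightarrow> t \<in> toggled S k"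
  by (induction k) auto

lemma toggled_limit_cong:
  "(\<And>j. s \<in> S j \<longleftrightarrow> t \<in> S j) \<Longrightarrow> s \<in> toggled_limit S \<longleftrightarrow> t \<in> toggled_limit S"
  using toggled_cong[of s S t] unfolding toggled_limit_def by blast

lemma toggled_limit_eq_toggled:
  assumes "\<And>j. k \<le> j \<Longrightarrow> t \<notin> S j"
  shows "t \<in> toggled_limit S \<longleftrightarrow> t \<in> toggled S k"
proof -
  have eq: "t \<in> toggled S j \<longleftrightarrow> t \<in> toggled S k" if "k \<le> j" for j
    using that by (induction j rule: dec_induct) (use assms in auto)
  show ?thesis
  proof
    assume "t \<in> toggled_limit S"
    then obtain l where "\<And>j. l \<le> j \<Longrightarrow> t \<in> toggled S j" by (auto simp: toggled_limit_def)
    then have "t \<in> toggled S (max k l)" using max.cobounded2 by blast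
    then show "t \<in> toggled S k" using eq[of "max k l"] max.cobounded1 by blast
  next
    assume "t \<in> toggled S k"
    then have "t \<in> (\<Inter>j\<in>{k..}. toggled S j)" using eq by blast
    then show "t \<in> toggled_limit S" unfolding toggled_limit_def by blast
  qed
qed

section \<open>Oscillation at one scale\<close>

context bell_kernel begin

text \<open>
  On the block around \<open>x\<close> the set \<open>F\<close> is constant, so \<open>E\<close> or its complement is just the middle cell there, and
  \<open>mean_drop_at_bump\<close> applies. With cell width \<open>H / n\<^sup>2\<close> and shift \<open>H / n\<close> its two error terms are
  at most \<open>2 / (n - 2)\<close> and \<open>4 / (n - 2)\<close>, which the lower bound on \<open>n\<close> keeps below \<open>p / 4\<close>.
\<close>
lemma toggled_middle_cell_oscillation:
  assumes F: "F \<in> sets lebesgue" "\<And>t. t + 2 * pi \<in> F \<longleftrightarrow> t \<in> F" "level_constant m F"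
    and n: "odd n" "4 + 24 / p \<le> real n" and m: "0 < m" and p: "0 < p"
    and H: "H = 2 * pi / real m"
    and mass: "(LINT t:{-pi..pi}|lebesgue. f t) \<le> 2"
    and core: "p \<le> (LINT t:{-H/(2*real (n^2))..H/(2*real (n^2))}|lebesgue. f t)"
    and x: "x = (of_int i + 1/2) * H"
    and E: "E = sym_diff F (middle_cells (n^2 * m) (n^2))"
  shows "3 / 4 * p \<le> \<bar>mean x (indicator E) - mean (x + H / real n) (indicator E)\<bar>"
proof -
  have n4: "4 \<le> real n" using n(2) divide_nonneg_pos[of 24 p] p by linarith
  define a where "a = H / (2 * real (n^2))"
  define \<tau> where "\<tau> = H / real n"
  define R where "R = H / 2"
  have Hpos: "0 < H" using m H by simp
  have H2pi: "H \<le> 2 * pi" using m by (simp add: H divide_le_eq mult_le_cancel_left1)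
  have a: "a = H * (1 / (2 * (real n)\<^sup>2))" and \<tau>: "\<tau> = H * (1 / real n)" and R: "R = H * (1 / 2)"
    by (simp_all add: a_def \<tau>_def R_def)
  have par: "0 < a" "a < \<tau>" "2 * \<tau> \<le> R" "R \<le> pi"
  proof -
    show "0 < a" using Hpos n4 by (simp add: a)
    have "1 / (2 * (real n)\<^sup>2) < 1 / real n" using n4 by (simp add: field_simps power2_eq_square)
    then show "a < \<tau>" unfolding a \<tau> using Hpos by (rule mult_strict_left_mono)
    show "2 * \<tau> \<le> R" using Hpos n4 by (simp add: \<tau> R field_simps)
    show "R \<le> pi" using H2pi by (simp add: R)
  qed
  have tail: "s * f s \<le> 1" if "0 < s" "s \<le> pi" for s
    using pointwise_bound[OF that] mass by simp
  have err: "2 * a * f (\<tau> - a) + 2 * \<tau> * f (R - \<tau>) \<le> p / 4"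
  proof -
    have ratio1: "2 * a = 2 / (2 * real n - 1) * (\<tau> - a)"
      using n4 by (simp add: a \<tau> field_simps power2_eq_square)
    have "2 * a * f (\<tau> - a) = 2 / (2 * real n - 1) * ((\<tau> - a) * f (\<tau> - a))"
      by (subst ratio1) simp
    also have "\<dots> \<le> 2 / (2 * real n - 1) * 1"
      using n4 par by (intro mult_left_mono tail) auto
    also have "\<dots> \<le> 2 / (real n - 2)"
      using n4 by (simp add: frac_le)
    finally have 1: "2 * a * f (\<tau> - a) \<le> 2 / (real n - 2)" .
    have ratio2: "2 * \<tau> = 4 / (real n - 2) * (R - \<tau>)"
      using n4 by (simp add: R \<tau> field_simps)
    have "2 * \<tau> * f (R - \<tau>) = 4 / (real n - 2) * ((R - \<tau>) * f (R - \<tau>))"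
      by (subst ratio2) simp
    also have "\<dots> \<le> 4 / (real n - 2) * 1"
      using n4 par by (intro mult_left_mono tail) auto
    finally have "2 * a * f (\<tau> - a) + 2 * \<tau> * f (R - \<tau>) \<le> 6 / (real n - 2)"
      using 1 by (simp add: add_divide_distrib[symmetric])
    also have "\<dots> \<le> p / 4"
    proof -
      have "24 / p \<le> real n - 2" using n(2) by simp
      then show ?thesis using p n4 by (simp add: field_simps)
    qed
    finally show ?thesis .
  qed
  have drop: "3 / 4 * p \<le> mean x w - mean (x + \<tau>) w"
    if w: "periodic_fun_simple w (2 * pi)" "w \<in> borel_measurable lebesgue" "\<And>t. 0 \<le> w t \<and> w t \<le> 1"
     "\<And>u. u \<in> {-a..<a} \<Longrightarrow> w (x + u) = 1" "\<And>u. u \<in> {-R..<R} \<Longrightarrow> u \<notin> {-a..<a} \<Longrightarrow> w (x + u) = 0" for w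
    using mean_drop_at_bump[OF w par] err core by (simp add: a_def)
  have aR: "a \<le> R" using par by linarith
  have cells: "x + u \<in> middle_cells (n^2 * m) (n^2) \<longleftrightarrow> u \<in> {-a..<a}"
    and Fc: "x + u \<in> F \<longleftrightarrow> x \<in> F" if "u \<in> {-R..<R}" for u
  proof -
    have u: "u \<in> {-H/2..<H/2}" and z: "0 \<in> {-H/2..<H/2}"
      using that Hpos by (simp_all add: R_def)
    have o: "odd (n^2)" using n by simp
    note nc = middle_cells_near_centre[OF o m H x]
    show "x + u \<in> middle_cells (n^2 * m) (n^2) \<longleftrightarrow> u \<in> {-a..<a}"
      using nc(2)[OF u] by (simp add: a_def)
    show "x + u \<in> F \<longleftrightarrow> x \<in> F"
      using F(3) nc(1)[OF u] nc(1)[OF z] by (simp add: level_constant_def)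
  qed
  have Em: "E \<in> sets lebesgue"
    unfolding E by (intro sets.Un sets.Diff F(1) middle_cells_measurable)
  have Ep: "t + 2 * pi \<in> E \<longleftrightarrow> t \<in> E" for t
    unfolding E using F(2)[of t] middle_cells_periodic[of "n^2" "n^2 * m" t] by auto
  have E_local: "x + u \<in> E \<longleftrightarrow> (x \<in> F) \<noteq> (u \<in> {-a..<a})" if "u \<in> {-R..<R}" for u
    using cells[OF that] Fc[OF that] by (auto simp: E)
  have bump_R: "u \<in> {-R..<R}" if "u \<in> {-a..<a}" for u
    using that aR by auto
  have E1: "periodic_fun_simple (indicat_real E) (2 * pi)"
    by unfold_locales (simp add: indicator_def Ep)
  have E2: "indicat_real E \<in> borel_measurable lebesgue" using Em by (rule borel_measurable_indicator)
  have E3: "0 \<le> indicat_real E t \<and> indicat_real E t \<le> 1" for t by (simp add: indicator_def)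
  show ?thesis
  proof (cases "x \<in> F")
    case False
    have "3 / 4 * p \<le> mean x (indicator E) - mean (x + \<tau>) (indicator E)"
    proof (rule drop[OF E1 E2 E3])
      show "indicat_real E (x + u) = 1" if "u \<in> {-a..<a}" for u
        using E_local[OF bump_R[OF that]] that False by simp
      show "indicat_real E (x + u) = 0" if "u \<in> {-R..<R}" "u \<notin> {-a..<a}" for u
        using E_local[OF that(1)] that False by simp
    qed
    then show ?thesis unfolding \<tau>_def by linarith
  next
    case True
    interpret E: periodic_fun_simple "indicat_real E" "2 * pi" by (rule E1)
    have "3 / 4 * p \<le> mean x (\<lambda>t. 1 - indicat_real E t) - mean (x + \<tau>) (\<lambda>t. 1 - indicat_real E t)"
    proof (rule drop)
      show "periodic_fun_simple (\<lambda>t. 1 - indicat_real E t) (2 * pi)"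
        by unfold_locales (simp add: E.plus_period)
      show "(\<lambda>t. 1 - indicat_real E t) \<in> borel_measurable lebesgue" using E2 by measurable
      show "0 \<le> 1 - indicat_real E t \<and> 1 - indicat_real E t \<le> 1" for t using E3[of t] by simp
      show "1 - indicat_real E (x + u) = 1" if "u \<in> {-a..<a}" for u
        using E_local[OF bump_R[OF that]] that True by simp
      show "1 - indicat_real E (x + u) = 0" if "u \<in> {-R..<R}" "u \<notin> {-a..<a}" for u
        using E_local[OF that(1)] that True by simp
    qed
    then show ?thesis unfolding mean_complement[OF E1 E2 E3] \<tau>_def by linarith
  qed
qed

end

section \<open>Choice of the scales and divergence\<close>

text \<open>
  If the means were close to some \<open>A\<close> on the whole interval, any two of its values would be close to each other.
  The two points may depend on \<open>r\<close>, and \<open>r\<close> need only run through a sequence.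
\<close>
lemma lam_divergentI:
  assumes c: "0 < c"
    and freq: "\<exists>\<^sub>F r in at_left 1. \<exists>\<theta>\<in>{x - lam r..x + lam r}. \<exists>\<theta>'\<in>{x - lam r..x + lam r}. c \<le> \<bar>F r \<theta> - F r \<theta>'\<bar>"
  shows "lam_divergent lam F x"
  unfolding lam_divergent_def
proof
  assume "\<exists>A. lam_convergent lam F x A"
  then obtain A where "((\<lambda>r. SUP \<theta>\<in>{x - lam r..x + lam r}. ennreal \<bar>F r \<theta> - A\<bar>) \<longlongrightarrow> 0) (at_left 1)"
    unfolding lam_convergent_def by blast
  then have "\<forall>\<^sub>F r in at_left 1. (SUP \<theta>\<in>{x - lam r..x + lam r}. ennreal \<bar>F r \<theta> - A\<bar>) < ennreal (c / 2)"
    using c by (intro order_tendstoD(2)) auto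
  then have "\<forall>\<^sub>F r in at_left 1. \<not> (\<exists>\<theta>\<in>{x - lam r..x + lam r}. \<exists>\<theta>'\<in>{x - lam r..x + lam r}. c \<le> \<bar>F r \<theta> - F r \<theta>'\<bar>)"
  proof eventually_elim
    case (elim r)
    have "\<bar>F r \<theta> - A\<bar> < c / 2" if "\<theta> \<in> {x - lam r..x + lam r}" for \<theta>
    proof -
      have "ennreal \<bar>F r \<theta> - A\<bar> < ennreal (c / 2)"
        using elim that by (meson SUP_upper le_less_trans)
      then show ?thesis by (simp add: ennreal_less_iff)
    qed
    then show ?case by (smt (verit) field_sum_of_halves)
  qed
  then show False using freq by (simp add: frequently_def)
qed

text \<open>
  The mass of \<open>[-\<delta>\<lambda>(r), \<delta>\<lambda>(r)]\<close> increases with \<open>\<delta>\<close>, so the outer upper limit is an infimum and its lower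
  bound holds for every \<open>\<delta>\<close>.
\<close>
lemma Pi_infty_pos_imp_concentration:
  assumes pos: "Pi_infty lam \<phi> > 0"
    and lam: "\<And>r. r \<in> {0<..<1} \<Longrightarrow> lam r > 0"
    and kernel: "\<And>r. r \<in> {0<..<1} \<Longrightarrow> bell_kernel (\<phi> r)"
  obtains p where "0 < p"
    and "\<And>\<delta>. 0 < \<delta> \<Longrightarrow> \<exists>\<^sub>F r in at_left 1. p \<le> (LINT t:{- \<delta> * lam r..\<delta> * lam r}|lebesgue. \<phi> r t)"
proof -
  let ?I = "\<lambda>\<delta> r. LINT t:{- \<delta> * lam r..\<delta> * lam r}|lebesgue. \<phi> r t"
  obtain p where p: "0 < ereal p" "ereal p < Pi_infty lam \<phi>"
    using pos ereal_dense2[of 0 "Pi_infty lam \<phi>"] by blast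
  show ?thesis
  proof
    show "0 < p" using p(1) by simp
    fix \<delta> :: real assume \<delta>: "0 < \<delta>"
    show "\<exists>\<^sub>F r in at_left 1. p \<le> ?I \<delta> r"
    proof (rule ccontr)
      assume "\<not> ?thesis"
      then have small: "\<forall>\<^sub>F r in at_left 1. ?I \<delta> r < p"
        by (simp add: frequently_def not_le)
      have "Pi_infty lam \<phi> \<le> ereal p"
        unfolding Pi_infty_def
      proof (rule Limsup_bounded)
        have "\<forall>\<^sub>F d in at_right 0. d \<in> {0<..<\<delta>}" using \<delta> by (rule eventually_at_right_real)
        then show "\<forall>\<^sub>F d in at_right 0. Limsup (at_left 1) (\<lambda>r. ereal (?I d r)) \<le> ereal p"
        proof eventually_elim
          case (elim d)
          have "\<forall>\<^sub>F r in at_left 1. r \<in> {0::real<..<1}" by (rule eventually_at_left_real) simp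
          with small have "\<forall>\<^sub>F r in at_left 1. ereal (?I d r) \<le> ereal p"
          proof eventually_elim
            case (elim r)
            interpret bell_kernel "\<phi> r" using elim by (intro kernel) auto
            have "d * lam r \<le> \<delta> * lam r"
              using \<open>d \<in> _\<close> lam[of r] elim by (intro mult_right_mono) auto
            then have "?I d r \<le> ?I \<delta> r" by (intro integral_mono_Icc) auto
            then show ?case using elim by simp
          qed
          then show ?case by (rule Limsup_bounded)
        qed
      qed
      then show False using p(2) by simp
    qed
  qed
qed

lemma regular_approximate_identity_imp_bell_kernel:
  assumes "regular_approximate_identity \<phi>" and r: "r \<in> {0<..<1}" and "\<And>t. \<phi> r (- t) = \<phi> r t"
  shows "bell_kernel (\<phi> r)"
proof -
  have "Linf_circle (\<phi> r)" "\<forall>t. 0 \<le> \<phi> r t" "antimono_on {0..pi} (\<phi> r)"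
    using assms by (auto simp: regular_approximate_identity_def approximate_identity_def)
  then show ?thesis
    using assms(3) by (auto simp: bell_kernel_def bell_kernel_axioms_def Linf_circle_def)
qed

text \<open>
  The order of the choices matters. First \<open>n\<close> is fixed, then \<open>r\<close> is taken such that mass \<open>p\<close> sits within
  \<open>\<delta> \<lambda>(r)\<close> for \<open>\<delta> = 1 / (4 n\<^sup>2)\<close>, and last \<open>m\<close> is the least multiple of \<open>N\<close> with \<open>2\<pi> / m \<le> \<lambda>(r)\<close>. As
  \<open>\<lambda>(r) < 2\<pi> / N\<close>, rounding to a multiple of \<open>N\<close> at most halves the block length, so a middle cell
  still contains \<open>[-\<delta>\<lambda>(r), \<delta>\<lambda>(r)]\<close> around its centre.
\<close>
lemma next_scale:
  fixes \<phi> :: "real \<Rightarrow> real \<Rightarrow> real" and lam :: "real \<Rightarrow> real"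
  assumes ident: "((\<lambda>r. LINT t:{-pi..pi}|lebesgue. \<phi> r t) \<longlongrightarrow> 1) (at_left 1)"
    and lam: "\<And>r. r \<in> {0<..<1} \<Longrightarrow> lam r > 0" "(lam \<longlongrightarrow> 0) (at_left 1)"
    and kernel: "\<And>r. r \<in> {0<..<1} \<Longrightarrow> bell_kernel (\<phi> r)"
    and conc: "\<And>\<delta>. 0 < \<delta> \<Longrightarrow> \<exists>\<^sub>F r in at_left 1. p \<le> (LINT t:{- \<delta> * lam r..\<delta> * lam r}|lebesgue. \<phi> r t)"
    and r0: "r0 < 1" and "0 < N"
  obtains r n m where "r0 < r" "r \<in> {0<..<1}" "odd n" "K \<le> real n" "0 < m" "N dvd m"
    "2 * pi / real m \<le> lam r" "(LINT t:{-pi..pi}|lebesgue. \<phi> r t) \<le> 2"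
    "p \<le> (LINT t:{-(2 * pi / real m)/(2*real (n^2))..(2 * pi / real m)/(2*real (n^2))}|lebesgue. \<phi> r t)"
proof -
  define n where "n = 2 * nat \<lceil>K\<rceil> + 1"
  have n: "odd n" "K \<le> real n" "0 < n"
    unfolding n_def by (simp_all add: le_nat_iff) linarith
  define \<delta> where "\<delta> = 1 / (4 * real (n^2))"
  have \<delta>: "0 < \<delta>" using n by (simp add: \<delta>_def)
  have "\<forall>\<^sub>F r in at_left 1. r \<in> {max r0 0<..<1}"
    by (rule eventually_at_left_real) (use r0 in simp)
  moreover have "\<forall>\<^sub>F r in at_left 1. lam r < 2 * pi / real N"
    using lam(2) \<open>0 < N\<close> by (intro order_tendstoD(2)) auto
  moreover have "\<forall>\<^sub>F r in at_left 1. (LINT t:{-pi..pi}|lebesgue. \<phi> r t) < 2"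
    using ident by (intro order_tendstoD(2)) auto
  ultimately have "\<forall>\<^sub>F r in at_left 1. r \<in> {max r0 0<..<1} \<and> lam r < 2 * pi / real N \<and>
      (LINT t:{-pi..pi}|lebesgue. \<phi> r t) < 2"
    by eventually_elim auto
  then obtain r where r: "p \<le> (LINT t:{- \<delta> * lam r..\<delta> * lam r}|lebesgue. \<phi> r t)"
      "r \<in> {max r0 0<..<1}" "lam r < 2 * pi / real N" "(LINT t:{-pi..pi}|lebesgue. \<phi> r t) < 2"
    using frequently_ex[OF frequently_eventually_conj[OF conc[OF \<delta>]]] by blast
  have r01: "r \<in> {0<..<1}" "r0 < r" using r(2) by auto
  have lr: "0 < lam r" by (rule lam(1)[OF r01(1)])
  interpret bell_kernel "\<phi> r" by (rule kernel[OF r01(1)])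
  define j where "j = nat \<lceil>2 * pi / (real N * lam r)\<rceil>"
  have j0: "0 < 2 * pi / (real N * lam r)" using lr \<open>0 < N\<close> by simp
  then have j: "2 * pi / (real N * lam r) \<le> real j" "real j < 2 * pi / (real N * lam r) + 1" "0 < j"
    unfolding j_def by linarith+
  define m where "m = N * j"
  have m: "0 < m" "N dvd m" using j \<open>0 < N\<close> by (simp_all add: m_def)
  have fine: "2 * pi / real m \<le> lam r"
    using j(1) j(3) \<open>0 < N\<close> lr by (simp add: m_def field_simps)
  have "real N * lam r * real j \<le> 2 * pi + real N * lam r"
    using j(2) lr \<open>0 < N\<close> by (simp add: field_simps)
  also have "\<dots> \<le> 4 * pi" using r(3) \<open>0 < N\<close> by (simp add: field_simps)
  finally have "lam r * real m \<le> 4 * pi" by (simp add: m_def mult_ac)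
  then have "\<delta> * lam r \<le> (2 * pi / real m)/(2*real (n^2))"
    using m n by (simp add: \<delta>_def field_simps)
  then have "p \<le> (LINT t:{-(2 * pi / real m)/(2*real (n^2))..(2 * pi / real m)/(2*real (n^2))}|lebesgue. \<phi> r t)"
    by (intro order_trans[OF r(1) integral_mono_Icc]) auto
  then show ?thesis
    using that r01 n m fine r(4) by fastforce
qed

theorem theorem1p6:
  fixes \<phi> :: "real \<Rightarrow> real \<Rightarrow> real" and lam :: "real \<Rightarrow> real"
  assumes "regular_approximate_identity \<phi>"
    and "\<And>r t. r \<in> {0<..<1} \<Longrightarrow> \<phi> r (- t) = \<phi> r t"
    and "\<And>r. r \<in> {0<..<1} \<Longrightarrow> lam r > 0"
    and "(lam \<longlongrightarrow> 0) (at_left 1)"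
    and "Pi_infty lam \<phi> > 0"
  shows "\<exists>E. periodic_set E \<and> E \<in> sets lebesgue \<and>
           (\<forall>x. lam_divergent lam (\<lambda>r \<theta>. conv_mean \<phi> r \<theta> (indicator E)) x)"
proof -
  have kernel: "bell_kernel (\<phi> r)" if "r \<in> {0<..<1}" for r
    using assms(1) that assms(2)[OF that] by (rule regular_approximate_identity_imp_bell_kernel)
  have ident: "((\<lambda>r. LINT t:{-pi..pi}|lebesgue. \<phi> r t) \<longlongrightarrow> 1) (at_left 1)"
    using assms(1) by (simp add: regular_approximate_identity_def approximate_identity_def)
  obtain p where p: "0 < p"
    and conc: "\<And>\<delta>. 0 < \<delta> \<Longrightarrow> \<exists>\<^sub>F r in at_left 1. p \<le> (LINT t:{- \<delta> * lam r..\<delta> * lam r}|lebesgue. \<phi> r t)"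
    by (rule Pi_infty_pos_imp_concentration[OF assms(5,3) kernel]) (assumption | rule that)+
  note next_scale = next_scale[where \<phi> = \<phi> and lam = lam and p = p, OF ident assms(3,4) kernel conc]
  \<comment> \<open>A stage is \<open>(r, n, m, B)\<close>, where \<open>B\<close> bounds the sup norms of all kernels chosen so far. The
    conditions \<open>Q\<close> on successive stages give nested subdivisions and make the next set negligible for
    all earlier kernels.\<close>
  define P where "P = (\<lambda>k (r, n, m, B). 1 - 1 / real (Suc k) < r \<and> r \<in> {0<..<1} \<and> odd n \<and>
    4 + 24 / p \<le> real n \<and> 0 < m \<and> 2 * pi / real m \<le> lam r \<and>
    (LINT t:{-pi..pi}|lebesgue. \<phi> r t) \<le> 2 \<and>
    p \<le> (LINT t:{-(2 * pi / real m)/(2*real (n^2))..(2 * pi / real m)/(2*real (n^2))}|lebesgue. \<phi> r t) \<and>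
    \<phi> r 0 \<le> B)"
  define Q where "Q = (\<lambda>(k::nat) (r::real, n::nat, m::nat, B::real) (r'::real, n'::nat, m'::nat, B'::real). n\<^sup>2 * m dvd m' \<and> B \<le> B' \<and>
    B * (6 * pi / real (n'\<^sup>2)) \<le> p / 8 * (1 / 2) ^ Suc k)"
  have "\<exists>s. \<forall>k. P k (s k) \<and> Q k (s k) (s (Suc k))"
  proof (rule dependent_nat_choice)
    obtain r n m where "0 < r" "r \<in> {0<..<1}" "odd n" "4 + 24 / p \<le> real n" "0 < m" "1 dvd m"
      "2 * pi / real m \<le> lam r" "(LINT t:{-pi..pi}|lebesgue. \<phi> r t) \<le> 2"
      "p \<le> (LINT t:{-(2 * pi / real m)/(2*real (n^2))..(2 * pi / real m)/(2*real (n^2))}|lebesgue. \<phi> r t)"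
      by (rule next_scale[of 0 1 "4 + 24 / p"]) auto
    then have "P 0 (r, n, m, \<phi> r 0)" by (simp add: P_def)
    then show "\<exists>s. P 0 s" ..
  next
    fix s k assume s: "P k s"
    obtain r n m B where s_eq: "s = (r, n, m, B)" by (cases s) auto
    define \<epsilon> where "\<epsilon> = p / 8 * (1 / 2) ^ Suc k"
    have \<epsilon>: "0 < \<epsilon>" using p by (simp add: \<epsilon>_def)
    \<comment> \<open>The second bound makes \<open>B\<close> times the measure of the next set at most \<open>\<epsilon>\<close>, as that measure is at most \<open>6\<pi> / n'\<^sup>2\<close>.\<close>
    define K where "K = max (4 + 24 / p) (B * (6 * pi) / \<epsilon>)"
    have "1 - 1 / real (Suc (Suc k)) < 1" by simp
    moreover have "0 < n\<^sup>2 * m" using s by (auto simp: s_eq P_def intro: Nat.gr0I)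
    ultimately obtain r' n' m' where r': "1 - 1 / real (Suc (Suc k)) < r'" "r' \<in> {0<..<1}" "odd n'"
      "K \<le> real n'" "0 < m'" "n\<^sup>2 * m dvd m'"
      "2 * pi / real m' \<le> lam r'" "(LINT t:{-pi..pi}|lebesgue. \<phi> r' t) \<le> 2"
      "p \<le> (LINT t:{-(2 * pi / real m')/(2*real (n'^2))..(2 * pi / real m')/(2*real (n'^2))}|lebesgue. \<phi> r' t)"
      by - (rule next_scale[of "1 - 1 / real (Suc (Suc k))" "n\<^sup>2 * m" K], (assumption | rule that)+)
    have n': "0 < n'" using r'(3) by (rule odd_pos)
    have "B * (6 * pi) / \<epsilon> \<le> real n'" using r'(4) by (simp add: K_def)
    also have "\<dots> \<le> real (n'\<^sup>2)" using n' by (simp add: power2_eq_square)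
    finally have "B * (6 * pi / real (n'\<^sup>2)) \<le> \<epsilon>"
      using \<epsilon> n' by (simp add: field_simps)
    then have "P (Suc k) (r', n', m', max B (\<phi> r' 0)) \<and> Q k s (r', n', m', max B (\<phi> r' 0))"
      using r' by (simp add: P_def Q_def s_eq K_def \<epsilon>_def)
    then show "\<exists>s'. P (Suc k) s' \<and> Q k s s'" ..
  qed
  then obtain s where s: "\<And>k. P k (s k)" "\<And>k. Q k (s k) (s (Suc k))" by blast
  define r where "r = (\<lambda>k. fst (s k))"
  define n where "n = (\<lambda>k. fst (snd (s k)))"
  define m where "m = (\<lambda>k. fst (snd (snd (s k))))"
  define B where "B = (\<lambda>k. snd (snd (snd (s k))))"
  have s_eq: "s k = (r k, n k, m k, B k)" for k by (simp add: r_def n_def m_def B_def)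
  have r: "1 - 1 / real (Suc k) < r k" "r k \<in> {0<..<1}" and n: "odd (n k)" "4 + 24 / p \<le> real (n k)"
    and m: "0 < m k" "2 * pi / real (m k) \<le> lam (r k)"
    and mass: "(LINT t:{-pi..pi}|lebesgue. \<phi> (r k) t) \<le> 2"
    and core: "p \<le> (LINT t:{-(2 * pi / real (m k))/(2*real ((n k)^2))..(2 * pi / real (m k))/(2*real ((n k)^2))}|lebesgue. \<phi> (r k) t)"
    and B: "\<phi> (r k) 0 \<le> B k" for k
    using s(1)[of k] by (auto simp: P_def s_eq)
  have dvd1: "(n k)\<^sup>2 * m k dvd m (Suc k)" and B1: "B k \<le> B (Suc k)"
    and small1: "B k * (6 * pi / real ((n (Suc k))\<^sup>2)) \<le> p / 8 * (1 / 2) ^ Suc k" for k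
    using s(2)[of k] by (auto simp: Q_def s_eq)
  have n0: "0 < n k" for k using n(1) by (rule odd_pos)
  have nested: "(n j)\<^sup>2 * m j dvd m k" if "j < k" for j k
    using that
  proof (induction k rule: less_Suc_induct)
    case (2 i j k)
    then show ?case by (meson dvd_trans dvd_triv_right)
  qed (rule dvd1)
  have B_mono: "B j \<le> B k" if "j \<le> k" for j k
    using lift_Suc_mono_le[of B, OF B1 that] .

  define S where "S = (\<lambda>k. middle_cells ((n k)\<^sup>2 * m k) ((n k)\<^sup>2))"
  define E where "E = toggled_limit S"
  have S_meas: "S k \<in> sets lebesgue" for k
    unfolding S_def by (rule middle_cells_measurable)
  have T_meas: "toggled S k \<in> sets lebesgue" for k
    by (rule toggled_measurable) (rule S_meas)
  have E_meas: "E \<in> sets lebesgue"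
    unfolding E_def by (rule toggled_limit_measurable) (rule S_meas)
  have S_per: "t + 2 * pi \<in> S k \<longleftrightarrow> t \<in> S k" for t k
    unfolding S_def by (rule middle_cells_periodic) simp
  have T_per: "t + 2 * pi \<in> toggled S k \<longleftrightarrow> t \<in> toggled S k" for t k
    by (rule toggled_cong) (rule S_per)
  have E_per: "t + 2 * pi \<in> E \<longleftrightarrow> t \<in> E" for t
    unfolding E_def by (rule toggled_limit_cong) (rule S_per)
  have T_level: "level_constant (m k) (toggled S k)" for k
    by (rule level_constant_toggled)
      (auto simp: S_def m intro: level_constant_middle_cells nested)

  have later: "B k * measure lebesgue (S j \<inter> {-pi..pi}) \<le> p / 8 * (1 / 2) ^ j" if kj: "k < j" for j k
  proof -
    obtain i where i: "j = Suc i" "k \<le> i" using kj by (cases j) auto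
    have B0: "0 \<le> B k"
      using B[of k] bell_kernel.nonneg[OF kernel[OF r(2)[of k]], of 0] by linarith
    have "B k * measure lebesgue (S j \<inter> {-pi..pi}) \<le> B k * (6 * pi / real ((n j)\<^sup>2))"
      using B0 measure_middle_cells[of "(n j)\<^sup>2" "m j"] n0 m(1) by (intro mult_left_mono) (auto simp: S_def)
    also have "\<dots> \<le> B i * (6 * pi / real ((n j)\<^sup>2))"
      by (intro mult_right_mono B_mono i) auto
    also have "\<dots> \<le> p / 8 * (1 / 2) ^ j" using small1[of i] i by simp
    finally show ?thesis .
  qed
  define D where "D = (\<lambda>k. \<Union>i. S (i + Suc k) \<inter> {-pi..pi})"
  have D_lm: "D k \<in> lmeasurable" for k
    by (rule fmeasurableI2[of "{-pi..pi}"]) (use S_meas in \<open>auto simp: D_def\<close>)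
  have D_small: "\<phi> (r k) 0 * measure lebesgue (D k) \<le> p / 8" for k
    unfolding D_def
  proof (rule measure_UN_geometric)
    show "S (i + Suc k) \<inter> {-pi..pi} \<in> lmeasurable" for i
      by (rule fmeasurableI2[of "{-pi..pi}"]) (use S_meas in auto)
    show \<phi>0: "0 \<le> \<phi> (r k) 0" by (rule bell_kernel.nonneg[OF kernel[OF r(2)]])
    show "\<phi> (r k) 0 * measure lebesgue (S (i + Suc k) \<inter> {-pi..pi}) \<le> p / 8 * (1 / 2) ^ Suc i" for i
    proof -
      have "\<phi> (r k) 0 * measure lebesgue (S (i + Suc k) \<inter> {-pi..pi})
          \<le> B k * measure lebesgue (S (i + Suc k) \<inter> {-pi..pi})"
        by (intro mult_right_mono B) auto
      also have "\<dots> \<le> p / 8 * (1 / 2) ^ (i + Suc k)" by (rule later) simp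
      also have "\<dots> \<le> p / 8 * (1 / 2) ^ Suc i"
        using p by (intro mult_left_mono power_decreasing) auto
      finally show ?thesis .
    qed
  qed (use p in simp)
  have osc: "\<exists>\<theta>\<in>{x - lam (r k)..x + lam (r k)}. \<exists>\<theta>'\<in>{x - lam (r k)..x + lam (r k)}.
      p / 2 \<le> \<bar>conv_mean \<phi> (r k) \<theta> (indicator E) - conv_mean \<phi> (r k) \<theta>' (indicator E)\<bar>" for x k
  proof -
    interpret bell_kernel "\<phi> (r k)" by (rule kernel[OF r(2)])
    have cm: "conv_mean \<phi> (r k) \<theta> w = mean \<theta> w" for \<theta> w
      by (simp add: conv_mean_def mean_def)
    define H where "H = 2 * pi / real (m k)"
    have H: "0 < H" "H \<le> lam (r k)" using m[of k] by (simp_all add: H_def)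
    define i where "i = \<lfloor>x / H\<rfloor>"
    \<comment> \<open>The centre of the block that contains \<open>x\<close>.\<close>
    define y where "y = (of_int i + 1/2) * H"
    have y: "\<bar>y - x\<bar> \<le> H / 2"
      using floor_divide_lower[OF H(1), of x] floor_divide_upper[OF H(1), of x]
      unfolding abs_le_iff by (simp_all add: y_def i_def algebra_simps)
    have n2: "2 \<le> real (n k)" using n(2)[of k] divide_nonneg_pos[of 24 p] p by linarith
    then have "H / real (n k) \<le> H / 2" using H by (intro divide_left_mono) auto
    then have in1: "y \<in> {x - lam (r k)..x + lam (r k)}"
      and in2: "y + H / real (n k) \<in> {x - lam (r k)..x + lam (r k)}"
    proof -
      have "0 \<le> H / real (n k)" using H by simp
      then show "y \<in> {x - lam (r k)..x + lam (r k)}"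
        "y + H / real (n k) \<in> {x - lam (r k)..x + lam (r k)}"
        using y H \<open>H / real (n k) \<le> H / 2\<close> unfolding abs_le_iff atLeastAtMost_iff by linarith+
    qed
    \<comment> \<open>The set \<open>E\<close> and the stage after \<open>S k\<close> differ only in the later sets \<open>S j\<close>, \<open>j > k\<close>.\<close>
    have close: "\<bar>mean \<theta> (indicator E) - mean \<theta> (indicator (toggled S (Suc k)))\<bar> \<le> p / 8" for \<theta>
    proof (rule order_trans[OF mean_indicator_close[OF E_meas T_meas D_lm] D_small])
      fix t assume t: "t \<in> {-pi..pi}" "t \<notin> D k"
      show "t \<in> E \<longleftrightarrow> t \<in> toggled S (Suc k)"
        unfolding E_def
      proof (rule toggled_limit_eq_toggled)
        fix j assume "Suc k \<le> j"
        then obtain i where "j = i + Suc k" by (metis le_Suc_ex add.commute)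
        then show "t \<notin> S j" using t by (auto simp: D_def)
      qed
    qed
    have "3 / 4 * p \<le> \<bar>mean y (indicator (toggled S (Suc k)))
        - mean (y + H / real (n k)) (indicator (toggled S (Suc k)))\<bar>"
      by (rule toggled_middle_cell_oscillation[OF T_meas T_per T_level n m(1) p H_def mass _ y_def])
        (use core[of k] in \<open>simp_all add: H_def S_def\<close>)
    then have "p / 2 \<le> \<bar>mean y (indicator E) - mean (y + H / real (n k)) (indicator E)\<bar>"
      using close[of y] close[of "y + H / real (n k)"] by linarith
    then show ?thesis using in1 in2 unfolding cm by blast
  qed
  have "lam_divergent lam (\<lambda>r \<theta>. conv_mean \<phi> r \<theta> (indicator E)) x" for x
  proof (rule lam_divergentI[of "p / 2"])
    show "0 < p / 2" using p by simp
    have rlim: "filterlim r (at_left 1) sequentially"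
      unfolding at_within_def filterlim_inf filterlim_principal
    proof
      show "r \<longlonglongrightarrow> 1"
      proof (rule tendsto_sandwich)
        show "(\<lambda>k. 1 - 1 / real (Suc k)) \<longlonglongrightarrow> 1"
          using LIMSEQ_inverse_real_of_nat_add_minus[of 1] by (simp add: inverse_eq_divide)
        show "\<forall>\<^sub>F k in sequentially. 1 - 1 / real (Suc k) \<le> r k" "\<forall>\<^sub>F k in sequentially. r k \<le> 1"
          using r by (auto intro!: always_eventually less_imp_le)
      qed simp
      show "\<forall>\<^sub>F k in sequentially. r k \<in> {..<1} - {1}"
        using r(2) by (auto intro!: always_eventually)
    qed
    show "\<exists>\<^sub>F r in at_left 1. \<exists>\<theta>\<in>{x - lam r..x + lam r}. \<exists>\<theta>'\<in>{x - lam r..x + lam r}.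
        p / 2 \<le> \<bar>conv_mean \<phi> r \<theta> (indicator E) - conv_mean \<phi> r \<theta>' (indicator E)\<bar>"
      unfolding frequently_def
    proof
      assume "\<forall>\<^sub>F r in at_left 1. \<not> (\<exists>\<theta>\<in>{x - lam r..x + lam r}. \<exists>\<theta>'\<in>{x - lam r..x + lam r}.
        p / 2 \<le> \<bar>conv_mean \<phi> r \<theta> (indicator E) - conv_mean \<phi> r \<theta>' (indicator E)\<bar>)"
      from eventually_happens'[OF sequentially_bot rlim[unfolded filterlim_iff, rule_format, OF this]]
      show False using osc[of x] by blast
    qed
  qed
  moreover have "periodic_set E"
    unfolding periodic_set_def by unfold_locales (simp add: E_per)
  ultimately show ?thesis using E_meas by blast
qed

end
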